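(* Fix $\varepsilon\in(0,1]$ and set $B:=\varepsilon^{-1}\int_0^\varepsilon A_\alpha\,d\alpha\in\mathbb{P}(\mathbb{Z}^+)$ (i.e. $B(k)=\varepsilon^{-1}\int_0^\varepsilon A_\alpha(k)\,d\alpha$). For $\beta\in(0,1)$ put $B_\beta:=\sum_{k\ge0}A_\beta(k)B^{(k)}$. Then $B_\beta\in\mathcal{A}$, and for each $\alpha\in(0,1)$, $$\lim_{\xi\to0}\frac{|\xi|^{\alpha}}{|1-\widehat{B_\beta}(\xi)|}=0.$$
   Context: For $\alpha\in(0,1)$, $A_\alpha\in\mathbb{P}(\mathbb{Z}^+)$ is given by $A_\alpha(0)=0$, $A_\alpha(k)=\alpha(1-\alpha)\cdots((k-1)-\alpha)/k!$ for $k\in\mathbb{N}$. $\mathbb{P}(\mathbb{Z}^+)$ is the set of functions $F:\mathbb{Z}\to[0,1]$ with $\sum F=1$ and $F(k)=0$ for $k<0$. $B^{(k)}$ is the $k$-th convolution power, $B^{(0)}=\delta_0$. $\widehat{F}(\xi)=\sum_kF(k)e^{-ik\xi}$. $\mathcal{A}=\{F\in\mathbb{P}(\mathbb{Z}^+):\sup_{n\in\mathbb{N}}n\sum_k|F^{(n)}(k)-F^{(n+1)}(k)|<\infty\}$. *)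

theory Defs
  imports "HOL-Analysis.Analysis"
begin

definition prob_Zplus :: "(int \<Rightarrow> real) set" where
  "prob_Zplus = {F. (\<forall>k. 0 \<le> F k \<and> F k \<le> 1) \<and> (\<forall>k<0. F k = 0)
                    \<and> (F has_sum 1) UNIV}"

definition A_fun :: "real \<Rightarrow> int \<Rightarrow> real" where
  "A_fun \<alpha> k = (if k \<le> 0 then 0
     else \<alpha> * (\<Prod>j\<in>{1..<nat k}. (real j - \<alpha>)) / fact (nat k))"

definition conv :: "(int \<Rightarrow> real) \<Rightarrow> (int \<Rightarrow> real) \<Rightarrow> int \<Rightarrow> real" where
  "conv F G k = (\<Sum>\<^sub>\<infinity>j. F j * G (k - j))"

fun conv_pow :: "(int \<Rightarrow> real) \<Rightarrow> nat \<Rightarrow> int \<Rightarrow> real" where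
  "conv_pow F 0 = (\<lambda>k. if k = 0 then 1 else 0)"
| "conv_pow F (Suc n) = conv F (conv_pow F n)"

definition fourier :: "(int \<Rightarrow> real) \<Rightarrow> real \<Rightarrow> complex" where
  "fourier F \<xi> = (\<Sum>\<^sub>\<infinity>k. complex_of_real (F k) * exp (- \<i> * of_int k * of_real \<xi>))"

definition classA :: "(int \<Rightarrow> real) set" where
  "classA = {F. F \<in> prob_Zplus \<and>
     (\<exists>C. \<forall>n::nat. n \<ge> 1 \<longrightarrow>
        (\<lambda>k. \<bar>conv_pow F n k - conv_pow F (Suc n) k\<bar>) summable_on UNIV \<and>
        real n * (\<Sum>\<^sub>\<infinity>k. \<bar>conv_pow F n k - conv_pow F (Suc n) k\<bar>) \<le> C)}"

definition B_avg :: "real \<Rightarrow> int \<Rightarrow> real" where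
  "B_avg \<epsilon> k = integral {0..\<epsilon>} (\<lambda>\<alpha>. A_fun \<alpha> k) / \<epsilon>"

definition B_sub :: "real \<Rightarrow> real \<Rightarrow> int \<Rightarrow> real" where
  "B_sub \<epsilon> \<beta> m = (\<Sum>k. A_fun \<beta> (int k) * conv_pow (B_avg \<epsilon>) k m)"

end

theory Submission
  imports Defs
begin

text \<open>
  Let \<open>f(z) = 1 - (1 - z)\<^sup>\<beta>\<close> be the generating function of \<open>A\<^sub>\<beta>\<close>, and \<open>b\<close> that of \<open>B\<close>. Then
  \<open>B\<^sub>\<beta>\<close> has generating function \<open>f \<circ> b\<close>, and composition with \<open>b\<close> does not increase the \<open>\<ell>\<^sup>1\<close> norm,
  so it suffices to bound the norm of \<open>f\<^sup>n - f\<^sup>n\<^sup>+\<^sup>1\<close> by a multiple of \<open>1/n\<close>. The equation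
  \<open>(1 - z) f' = \<beta> (1 - f)\<close> shows that the coefficients of \<open>(n + 1) \<beta> (f\<^sup>n - f\<^sup>n\<^sup>+\<^sup>1)\<close> are the increments of
  \<open>k p(k)\<close>, where \<open>p(k)\<close> are the coefficients of \<open>f\<^sup>n\<^sup>+\<^sup>1\<close>. This sequence is unimodal, so its total
  variation is at most twice its maximum, and the maximum is bounded uniformly in \<open>n\<close> because
  the coefficients of \<open>f\<^sup>n\<close> are \<open>O(n\<^sup>-\<^sup>1\<^sup>/\<^sup>\<beta>)\<close>, which follows by induction on \<open>n\<close>.

  For the limit, \<open>B\<^sub>\<beta>(k) \<ge> \<beta> B(k) \<ge> c k\<^sup>-\<^sup>1\<^sup>-\<^sup>\<delta>\<close> for every small \<open>\<delta> > 0\<close>; the terms with \<open>k|\<xi>|\<close> between 1 and 3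
  already give \<open>Re (1 - B\<^sub>\<beta>^(\<xi>)) \<ge> c' |\<xi>|\<^sup>\<delta>\<close>.
\<close>

section \<open>Sibuya distributions\<close>

text \<open>The coefficients of (1 - z)^(\<beta> - 1); by \<open>sum_A_fun\<close> they complement
  the partial sums of \<open>A_fun \<beta>\<close>.\<close>

definition sibuya_tail :: "real \<Rightarrow> nat \<Rightarrow> real" where
  "sibuya_tail \<beta> k = (\<Prod>i = 1..k. 1 - \<beta> / real i)"

text \<open>For sequences vanishing on the negative integers nothing is lost, and convolution
  becomes a product of formal series, with no convergence to check.\<close>

definition seq_fps :: "(int \<Rightarrow> real) \<Rightarrow> real fps" where
  "seq_fps F = Abs_fps (\<lambda>n. F (int n))"

abbreviation sibuya :: "real \<Rightarrow> real fps" where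
  "sibuya \<beta> \<equiv> seq_fps (A_fun \<beta>)"

lemma fps_nth_seq_fps: "fps_nth (seq_fps F) = (\<lambda>n. F (int n))"
  by (simp add: seq_fps_def fun_eq_iff)

lemma seq_fps_nth [simp]: "fps_nth (seq_fps F) n = F (int n)"
  by (simp add: fps_nth_seq_fps)

text \<open>Bernoulli's inequality for exponents in [0, 1]: weighted AM-GM of \<open>1 + x\<close>
  and 1. Positivity there excludes \<open>x = -1\<close>, which is treated apart.\<close>

lemma powr_one_plus_le:
  fixes x b :: real
  assumes "0 \<le> b" "b \<le> 1" "-1 \<le> x"
  shows "(1 + x) powr b \<le> 1 + b * x"
proof (cases "x = -1")
  case False
  then show ?thesis
    using Youngs_inequality_0[of b "1 - b" "1 + x" 1] assms by (simp add: algebra_simps)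
qed (use assms in simp)

lemma sibuya_tail_0 [simp]: "sibuya_tail \<beta> 0 = 1"
  by (simp add: sibuya_tail_def)

lemma sibuya_tail_Suc: "sibuya_tail \<beta> (Suc k) = sibuya_tail \<beta> k * (1 - \<beta> / real (Suc k))"
  by (simp add: sibuya_tail_def)

lemma sibuya_tail_nonneg:
  assumes "\<beta> \<le> 1" shows "0 \<le> sibuya_tail \<beta> k"
  unfolding sibuya_tail_def using assms by (intro prod_nonneg) (auto simp: field_simps)

lemma A_fun_nonpos [simp]: "k \<le> 0 \<Longrightarrow> A_fun \<beta> k = 0"
  by (simp add: A_fun_def)

lemma A_fun_Suc: "A_fun \<beta> (int (Suc k)) = \<beta> / real (Suc k) * sibuya_tail \<beta> k"
proof -
  have "(\<Prod>j = 1..<Suc k. real j - \<beta>) = fact k * sibuya_tail \<beta> k"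
  proof (induction k)
    case (Suc k)
    then show ?case
      by (simp add: sibuya_tail_Suc field_simps)
  qed simp
  then show ?thesis
    by (simp add: A_fun_def nat_add_distrib divide_simps del: prod.op_ivl_Suc)
qed

lemma A_fun_nonneg:
  assumes "0 \<le> \<beta>" "\<beta> \<le> 1" shows "0 \<le> A_fun \<beta> (int k)"
proof (cases k)
  case (Suc j)
  then show ?thesis
    using assms sibuya_tail_nonneg[of \<beta> j] by (simp only: A_fun_Suc) simp
qed simp

lemma sum_A_fun: "(\<Sum>k\<le>n. A_fun \<beta> (int k)) = 1 - sibuya_tail \<beta> n"
proof (induction n)
  case (Suc n)
  have "(\<Sum>k\<le>Suc n. A_fun \<beta> (int k)) = 1 - sibuya_tail \<beta> n + A_fun \<beta> (int (Suc n))"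
    using Suc.IH by simp
  also have "\<dots> = 1 - sibuya_tail \<beta> (Suc n)"
    by (simp only: A_fun_Suc sibuya_tail_Suc) (simp add: algebra_simps)
  finally show ?case .
qed simp

text \<open>Induction: with \<open>x = 1 / real (Suc k)\<close> the new factor is 1 - \<beta>x, and
  Bernoulli together with (1 - \<beta>x)(1 + \<beta>x) \<le> 1 bounds it by (1 +
  x)^(-\<beta>).\<close>

lemma sibuya_tail_le:
  assumes "0 \<le> \<beta>" "\<beta> \<le> 1"
  shows "sibuya_tail \<beta> k \<le> real (Suc k) powr - \<beta>"
proof (induction k)
  case (Suc k)
  define x where "x = 1 / real (Suc k)"
  have x: "0 < x" "x \<le> 1" by (auto simp: x_def)
  have "(1 - \<beta> * x) * (1 + x) powr \<beta> \<le> (1 - \<beta> * x) * (1 + \<beta> * x)"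
    using assms x by (intro mult_left_mono powr_one_plus_le) (auto simp: mult_le_one)
  also have "\<dots> = 1 - (\<beta> * x)\<^sup>2" by (simp add: algebra_simps power2_eq_square)
  also have "\<dots> \<le> 1" by simp
  finally have "1 - \<beta> * x \<le> (1 + x) powr - \<beta>"
    using x by (simp add: powr_minus field_simps)
  then have "sibuya_tail \<beta> (Suc k) \<le> real (Suc k) powr - \<beta> * (1 + x) powr - \<beta>"
    unfolding sibuya_tail_Suc using Suc.IH sibuya_tail_nonneg[OF assms(2)] assms x
    by (intro mult_mono) (auto simp: x_def field_simps)
  also have "\<dots> = (real (Suc k) * (1 + x)) powr - \<beta>"
    using x by (simp add: powr_mult)
  also have "real (Suc k) * (1 + x) = real (Suc (Suc k))"
    by (simp add: x_def field_simps)
  finally show ?case .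
qed simp

lemma sibuya_tail_ge:
  assumes "0 \<le> \<beta>" "\<beta> \<le> 1"
  shows "(1 - \<beta>) * real (Suc k) powr - \<beta> \<le> sibuya_tail \<beta> k"
proof -
  \<comment> \<open>The induction runs with the tail shifted by one: its first instance is an
    equality, which is the origin of the constant 1 - \<beta>.\<close>
  have "(1 - \<beta>) * real (Suc k) powr - \<beta> \<le> sibuya_tail \<beta> (Suc k)"
  proof (induction k)
    case (Suc k)
    define x where "x = 1 / real (Suc (Suc k))"
    have x: "0 < x" "x < 1" by (auto simp: x_def)
    have eq: "real (Suc k) = real (Suc (Suc k)) * (1 - x)"
      by (simp add: x_def field_simps)
    have "(1 - \<beta>) * real (Suc (Suc k)) powr - \<beta> =
        (1 - \<beta>) * real (Suc k) powr - \<beta> * (1 - x) powr \<beta>"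
      unfolding eq using x by (simp add: powr_mult powr_minus)
    also have "\<dots> \<le> sibuya_tail \<beta> (Suc k) * (1 - \<beta> * x)"
      using Suc.IH powr_one_plus_le[of \<beta> "- x"] sibuya_tail_nonneg[OF assms(2)] assms x
      by (intro mult_mono) auto
    also have "\<dots> = sibuya_tail \<beta> (Suc (Suc k))"
      by (simp add: sibuya_tail_Suc[of _ "Suc k"] x_def)
    finally show ?case .
  qed (simp add: sibuya_tail_Suc)
  also have "\<dots> \<le> sibuya_tail \<beta> k"
    using sibuya_tail_nonneg[OF assms(2), of k] assms
    by (auto simp: sibuya_tail_Suc intro!: mult_left_le)
  finally show ?thesis .
qed

lemma sums_A_fun:
  assumes "0 < \<beta>" "\<beta> \<le> 1"
  shows "(\<lambda>k. A_fun \<beta> (int k)) sums 1"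
proof -
  have "(\<lambda>n. sibuya_tail \<beta> n) \<longlonglongrightarrow> 0"
  proof (rule tendsto_sandwich[OF _ _ tendsto_const])
    show "\<forall>\<^sub>F n in sequentially. sibuya_tail \<beta> n \<le> real (Suc n) powr - \<beta>"
      using assms by (intro always_eventually allI sibuya_tail_le) auto
    show "(\<lambda>n. real (Suc n) powr - \<beta>) \<longlonglongrightarrow> 0"
      using assms by (intro tendsto_neg_powr filterlim_compose[OF filterlim_real_sequentially]
          filterlim_Suc) auto
  qed (use assms in \<open>auto intro!: always_eventually sibuya_tail_nonneg\<close>)
  then have "(\<lambda>n. 1 - sibuya_tail \<beta> n) \<longlonglongrightarrow> 1 - 0" by (intro tendsto_intros)
  then show ?thesis by (simp add: sums_def_le sum_A_fun)
qed

text \<open>A discrete integral comparison: by Bernoulli the increments of the right side dominate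
  the summands.\<close>

lemma sum_powr_neg_le:
  fixes \<beta> :: real
  assumes "0 \<le> \<beta>" "\<beta> < 1"
  shows "(\<Sum>i<n. real (Suc i) powr - \<beta>) \<le> real n powr (1 - \<beta>) / (1 - \<beta>)"
proof (induction n)
  case (Suc n)
  define x where "x = 1 / real (Suc n)"
  have x: "0 < x" "x \<le> 1" by (auto simp: x_def)
  have eq: "real n = real (Suc n) * (1 - x)"
    by (simp add: x_def field_simps)
  have "real n powr (1 - \<beta>) = real (Suc n) powr (1 - \<beta>) * (1 - x) powr (1 - \<beta>)"
    unfolding eq using x by (simp add: powr_mult)
  also have "\<dots> \<le> real (Suc n) powr (1 - \<beta>) * (1 - (1 - \<beta>) * x)"
    using powr_one_plus_le[of "1 - \<beta>" "- x"] assms x by (intro mult_left_mono) auto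
  also have "\<dots> = real (Suc n) powr (1 - \<beta>) - (1 - \<beta>) * real (Suc n) powr - \<beta>"
    by (simp add: x_def powr_diff powr_minus divide_simps)
  finally have "real n powr (1 - \<beta>) / (1 - \<beta>) + real (Suc n) powr - \<beta>
      \<le> real (Suc n) powr (1 - \<beta>) / (1 - \<beta>)"
    using assms by (simp add: le_divide_eq distrib_right)
      (simp add: field_simps)
  with Suc.IH show ?case by simp
qed simp

text \<open>Raise t \<le> exp t, taken at t = cx/a, to the power a.\<close>

lemma powr_le_exp:
  fixes a c x :: real
  assumes "0 < a" "0 < c" "0 \<le> x"
  shows "x powr a * exp (- c * x) \<le> (a / c) powr a"
proof -
  have "c * x / a \<le> exp (c * x / a)"
    using exp_ge_add_one_self[of "c * x / a"] by linarith
  then have "x \<le> a / c * exp (c * x / a)"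
    using assms by (simp add: field_simps)
  then have "x powr a \<le> (a / c * exp (c * x / a)) powr a"
    using assms by (intro powr_mono2) auto
  also have "\<dots> = (a / c) powr a * exp (c * x)"
    using assms by (simp add: powr_mult exp_powr_real del: times_divide_eq_left) simp
  finally show ?thesis
    using assms by (simp add: exp_minus field_simps)
qed

section \<open>Convolution powers of Sibuya distributions\<close>

abbreviation sibuya_pow :: "real \<Rightarrow> nat \<Rightarrow> nat \<Rightarrow> real" where
  "sibuya_pow \<beta> n k \<equiv> fps_nth (sibuya \<beta> ^ n) k"

definition sibuya_diff :: "real \<Rightarrow> nat \<Rightarrow> nat \<Rightarrow> real" where
  "sibuya_diff \<beta> n k = sibuya_pow \<beta> n k - sibuya_pow \<beta> (Suc n) k"

lemma fps_power_nonneg: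
  fixes f :: "real fps"
  assumes "\<And>k. 0 \<le> fps_nth f k"
  shows "0 \<le> fps_nth (f ^ n) k"
proof (induction n arbitrary: k)
  case (Suc n)
  then show ?case
    using assms by (auto simp: fps_mult_nth intro!: sum_nonneg)
qed simp

text \<open>The product involves the pairs in the triangle i + j \<le> n, which lies inside the
  square of side n.\<close>

lemma sum_fps_mult_le:
  fixes f g :: "real fps"
  assumes "\<And>k. 0 \<le> fps_nth f k" "\<And>k. 0 \<le> fps_nth g k"
  shows "(\<Sum>k\<le>n. fps_nth (f * g) k) \<le> (\<Sum>k\<le>n. fps_nth f k) * (\<Sum>k\<le>n. fps_nth g k)"
proof -
  have "(\<Sum>k\<le>n. fps_nth (f * g) k) = (\<Sum>k\<le>n. \<Sum>i\<le>k. fps_nth f i * fps_nth g (k - i))"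
    by (simp add: fps_mult_nth atLeast0AtMost)
  also have "\<dots> = (\<Sum>(i, j)\<in>{(i, j). i + j \<le> n}. fps_nth f i * fps_nth g j)"
    by (rule sum.triangle_reindex_eq[symmetric])
  also have "\<dots> \<le> (\<Sum>(i, j)\<in>{..n} \<times> {..n}. fps_nth f i * fps_nth g j)"
    using assms by (intro sum_mono2) auto
  also have "\<dots> = (\<Sum>k\<le>n. fps_nth f k) * (\<Sum>k\<le>n. fps_nth g k)"
    by (simp add: sum_product sum.cartesian_product)
  finally show ?thesis .
qed

lemma sum_fps_power_le:
  fixes f :: "real fps"
  assumes "\<And>k. 0 \<le> fps_nth f k"
  shows "(\<Sum>k\<le>n. fps_nth (f ^ m) k) \<le> (\<Sum>k\<le>n. fps_nth f k) ^ m"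
proof (induction m)
  case (Suc m)
  have "(\<Sum>k\<le>n. fps_nth (f ^ Suc m) k) \<le> (\<Sum>k\<le>n. fps_nth f k) * (\<Sum>k\<le>n. fps_nth (f ^ m) k)"
    unfolding power_Suc using assms fps_power_nonneg by (intro sum_fps_mult_le) auto
  also have "\<dots> \<le> (\<Sum>k\<le>n. fps_nth f k) * (\<Sum>k\<le>n. fps_nth f k) ^ m"
    using assms Suc.IH by (intro mult_left_mono sum_nonneg) auto
  finally show ?case by simp
qed simp

lemma fps_deriv_sibuya:
  "fps_deriv (sibuya \<beta>) = fps_const \<beta> * Abs_fps (sibuya_tail \<beta>)"
  by (rule fps_ext) (use A_fun_Suc in \<open>simp add: field_simps\<close>)

text \<open>Multiplying by \<open>1 - fps_X\<close> takes differences of the tails, and these are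
  the masses of \<open>A_fun \<beta>\<close> up to sign.\<close>

lemma sibuya_ode: "(1 - fps_X) * fps_deriv (sibuya \<beta>) = fps_const \<beta> * (1 - sibuya \<beta>)"
proof (rule fps_ext)
  fix k
  show "fps_nth ((1 - fps_X) * fps_deriv (sibuya \<beta>)) k = fps_nth (fps_const \<beta> * (1 - sibuya \<beta>)) k"
  proof (cases k)
    case 0
    then show ?thesis using A_fun_Suc[of \<beta> 0] by (simp add: algebra_simps fps_deriv_sibuya)
  next
    case (Suc j)
    have "sibuya_tail \<beta> (Suc j) - sibuya_tail \<beta> j = - A_fun \<beta> (int (Suc j))"
      unfolding A_fun_Suc sibuya_tail_Suc by (simp add: algebra_simps)
    then show ?thesis
      by (simp add: Suc fps_deriv_sibuya left_diff_distrib flip: right_diff_distrib)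
  qed
qed

text \<open>Coefficients of (f^(n+1))' = (n+1) f^n f'. This drives the induction on \<open>n\<close>
  in the size estimates.\<close>

lemma sibuya_pow_Suc_Suc:
  "real (Suc k) * sibuya_pow \<beta> (Suc n) (Suc k) =
     real (Suc n) * \<beta> * (\<Sum>j\<le>k. sibuya_pow \<beta> n j * sibuya_tail \<beta> (k - j))"
proof -
  have "real (Suc k) * sibuya_pow \<beta> (Suc n) (Suc k) = fps_nth (fps_deriv (sibuya \<beta> ^ Suc n)) k"
    by (simp del: power_Suc)
  also have "fps_deriv (sibuya \<beta> ^ Suc n) =
      fps_const (real (Suc n) * \<beta>) * (sibuya \<beta> ^ n * Abs_fps (sibuya_tail \<beta>))"
    by (simp only: fps_deriv_power fps_deriv_sibuya diff_Suc_1 fps_const_mult[symmetric] ac_simps)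
  finally show ?thesis
    by (simp only: fps_mult_left_const_nth) (simp add: fps_mult_nth atLeast0AtMost)
qed

text \<open>Multiply (f^(n+1))' = (n+1) f^n f' by 1 - z and insert
  \<open>sibuya_ode\<close>.\<close>

lemma sibuya_diff_eq:
  "real (Suc n) * \<beta> * sibuya_diff \<beta> n k =
     real (Suc k) * sibuya_pow \<beta> (Suc n) (Suc k) - real k * sibuya_pow \<beta> (Suc n) k"
proof -
  have "(1 - fps_X) * fps_deriv (sibuya \<beta> ^ Suc n) =
      fps_const (real (Suc n)) * sibuya \<beta> ^ n * ((1 - fps_X) * fps_deriv (sibuya \<beta>))"
    by (simp only: fps_deriv_power diff_Suc_1 ac_simps)
  also have "\<dots> = fps_const (real (Suc n) * \<beta>) * (sibuya \<beta> ^ n - sibuya \<beta> ^ Suc n)"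
    unfolding sibuya_ode fps_const_mult[symmetric] power_Suc by (simp only: algebra_simps mult_1_left)
  finally have "fps_nth ((1 - fps_X) * fps_deriv (sibuya \<beta> ^ Suc n)) k =
      real (Suc n) * \<beta> * sibuya_diff \<beta> n k"
    by (simp only: fps_mult_left_const_nth sibuya_diff_def fps_sub_nth)
  then show ?thesis
    by (cases k) (simp_all add: left_diff_distrib del: power_Suc)
qed

text \<open>\<open>sibuya_diff_eq\<close> telescopes, so a bound on the weighted coefficients of
  f^(n+1) controls all partial sums.\<close>

lemma sum_sibuya_diff:
  "real (Suc n) * \<beta> * (\<Sum>k<m. sibuya_diff \<beta> n k) = real m * sibuya_pow \<beta> (Suc n) m"
  unfolding sum_distrib_left sibuya_diff_eq
  using sum_lessThan_telescope[of "\<lambda>k. real k * sibuya_pow \<beta> (Suc n) k" m] by simp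

lemma sibuya_diff_rec_0:
  "real (Suc k) * sibuya_diff \<beta> 0 (Suc k) = (real k - \<beta>) * sibuya_diff \<beta> 0 k"
  using sibuya_diff_eq[of 0 \<beta> k]
  by (cases k) (simp_all add: sibuya_diff_def algebra_simps)

text \<open>Subtracting the instances \<open>n\<close> and \<open>Suc n\<close> of
  \<open>sibuya_diff_eq\<close> leaves only differences.\<close>

lemma sibuya_diff_rec:
  "real (Suc k) * sibuya_diff \<beta> (Suc n) (Suc k) =
     (real k - real (Suc (Suc n)) * \<beta>) * sibuya_diff \<beta> (Suc n) k + real (Suc n) * \<beta> * sibuya_diff \<beta> n k"
  using sibuya_diff_eq[of n \<beta> k] sibuya_diff_eq[of "Suc n" \<beta> k]
  unfolding sibuya_diff_def[of _ "Suc n"] by (simp add: algebra_simps del: power_Suc)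

lemma sibuya_diff_eq_0: "k < n \<Longrightarrow> sibuya_diff \<beta> n k = 0"
  using startsby_zero_power_prefix[of "sibuya \<beta>"] by (simp add: sibuya_diff_def del: power_Suc)

lemma sibuya_diff_same: "sibuya_diff \<beta> n n = \<beta> ^ n"
  using startsby_zero_power_prefix[of "sibuya \<beta>" "Suc n"] startsby_zero_power_nth_same[of "sibuya \<beta>" n]
    A_fun_Suc[of \<beta> 0]
  by (simp add: sibuya_diff_def del: power_Suc)

text \<open>The sign is that of n(1 - \<beta>)/2 - \<beta>, which increases with \<open>n\<close>;
  this settles the corner case of the sign analysis.\<close>

lemma sibuya_diff_Suc:
  "sibuya_diff \<beta> n (Suc n) = \<beta> ^ n * (real n * (1 - \<beta>) / 2 - \<beta>)"
proof (induction n)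
  case 0
  then show ?case using sibuya_diff_rec_0[of 0 \<beta>] by (simp add: sibuya_diff_same)
next
  case (Suc n)
  have "real (Suc (Suc n)) * sibuya_diff \<beta> (Suc n) (Suc (Suc n)) =
     real (Suc (Suc n)) * (\<beta> ^ Suc n * (real (Suc n) * (1 - \<beta>) / 2 - \<beta>))"
    unfolding sibuya_diff_rec sibuya_diff_same Suc.IH by (simp add: field_simps)
  then show ?case by (simp only: mult_cancel_left of_nat_eq_0_iff) simp
qed

text \<open>
  For fixed \<open>k\<close> the sequence \<open>n \<mapsto> sibuya_diff \<beta> n k\<close> changes sign once, from \<open>\<le> 0\<close> to \<open>\<ge> 0\<close>.
  The recursion in \<open>k\<close> is bidiagonal with nonnegative entries for \<open>n < k\<close>, so it keeps this
  pattern and can only move the threshold upwards; the corner \<open>n = k\<close>, where an entry may be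
  negative, is settled by the explicit value. As the threshold is monotone in \<open>k\<close>, for fixed \<open>n\<close>
  there is only one sign change in \<open>k\<close> as well.
\<close>

lemma sibuya_diff_sign_step:
  fixes \<beta> :: real
  assumes \<beta>: "0 < \<beta>" "\<beta> < 1"
    and N: "\<And>n. n < N \<Longrightarrow> sibuya_diff \<beta> n k \<le> 0" "\<And>n. N \<le> n \<Longrightarrow> 0 \<le> sibuya_diff \<beta> n k"
  obtains N' where "N \<le> N'" "\<And>n. n < N' \<Longrightarrow> sibuya_diff \<beta> n (Suc k) \<le> 0"
    "\<And>n. N' \<le> n \<Longrightarrow> 0 \<le> sibuya_diff \<beta> n (Suc k)"
proof -
  let ?d = "sibuya_diff \<beta>"
  have coef: "0 \<le> real k - real (Suc n) * \<beta>" if "n < k" for n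
  proof -
    have "real (Suc n) * \<beta> \<le> real k * 1"
      using that \<beta> by (intro mult_mono) auto
    then show ?thesis by simp
  qed
  \<comment> \<open>Otherwise the diagonal entry \<beta>^k would be nonpositive.\<close>
  have "N \<le> k"
    using N(1)[of k] zero_less_power[OF \<beta>(1), of k] by (force simp: sibuya_diff_same simp flip: not_less)
  have neg: "?d n (Suc k) \<le> 0" if "n < N" for n
  proof -
    have "real (Suc k) * ?d n (Suc k) \<le> 0"
    proof (cases n)
      case 0
      then show ?thesis unfolding 0 sibuya_diff_rec_0
        using coef[of 0] N(1)[of 0] that \<open>N \<le> k\<close> by (auto intro!: mult_nonneg_nonpos)
    next
      case (Suc m)
      then show ?thesis unfolding Suc sibuya_diff_rec
        using coef[of "Suc m"] N(1)[of "Suc m"] N(1)[of m] that Suc \<open>N \<le> k\<close> \<beta>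
        by (auto intro!: add_nonpos_nonpos mult_nonneg_nonpos)
    qed
    then show ?thesis by (simp add: mult_le_0_iff)
  qed
  have pos: "0 \<le> ?d n (Suc k)" if n: "N < n" for n
  proof -
    obtain m where m: "n = Suc m" "N \<le> m" using n by (cases n) auto
    consider "n < k" | "n = k" | "n = Suc k" | "Suc k < n" by linarith
    then show ?thesis
    proof cases
      case 1
      have "0 \<le> real (Suc k) * ?d n (Suc k)"
        unfolding m(1) sibuya_diff_rec
        using coef[OF 1] N(2)[of n] N(2)[of m] m n \<beta> by (auto intro!: add_nonneg_nonneg mult_nonneg_nonneg)
      then show ?thesis by (simp add: zero_le_mult_iff)
    next
      case 2
      \<comment> \<open>Since \<open>Suc m = k\<close>, the entry at \<open>m\<close> in column
        \<open>k\<close> lies next to the diagonal, so its sign is explicit and passes from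
        \<open>m\<close> to \<open>n = Suc m\<close>.\<close>
      have "0 \<le> ?d m (Suc m)" using N(2)[of m] m 2 by simp
      then have "0 \<le> real m * (1 - \<beta>) / 2 - \<beta>"
        using zero_less_power[OF \<beta>(1), of m] unfolding sibuya_diff_Suc by (simp only: zero_le_mult_iff) linarith
      also have "\<dots> \<le> real n * (1 - \<beta>) / 2 - \<beta>"
        using \<beta> m by (simp add: mult_right_mono)
      finally show ?thesis
        using \<beta> 2 by (simp add: sibuya_diff_Suc)
    next
      case 3
      then show ?thesis using \<beta> by (simp add: sibuya_diff_same del: power_Suc)
    next
      case 4
      then show ?thesis by (simp add: sibuya_diff_eq_0)
    qed
  qed
  \<comment> \<open>Only the sign at \<open>N\<close> itself is undetermined; the new threshold is
    \<open>N\<close> or \<open>Suc N\<close> accordingly.\<close>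
  show thesis
  proof (cases "0 \<le> ?d N (Suc k)")
    case True
    then show ?thesis
      using neg pos by (intro that[of N]) (auto simp: le_less)
  next
    case False
    then show ?thesis
      using neg pos by (intro that[of "Suc N"]) (auto simp: less_Suc_eq)
  qed
qed

lemma sibuya_diff_sign:
  assumes \<beta>: "0 < \<beta>" "\<beta> < 1"
  obtains N :: "nat \<Rightarrow> nat" where "mono N"
    "\<And>n k. n < N k \<Longrightarrow> sibuya_diff \<beta> n k \<le> 0" "\<And>n k. N k \<le> n \<Longrightarrow> 0 \<le> sibuya_diff \<beta> n k"
proof -
  let ?P = "\<lambda>k N. (\<forall>n<N. sibuya_diff \<beta> n k \<le> 0) \<and> (\<forall>n\<ge>N. 0 \<le> sibuya_diff \<beta> n k)"
  \<comment> \<open>Zero entries leave the thresholds ambiguous, so they are chosen successively to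
    make them monotone.\<close>
  have "\<exists>N. \<forall>k. ?P k (N k) \<and> N k \<le> N (Suc k)"
  proof (rule dependent_nat_choice)
    have "0 \<le> sibuya_diff \<beta> n 0" for n
      using sibuya_diff_same[of \<beta> 0] sibuya_diff_eq_0[of 0 n \<beta>] by (cases n) auto
    then show "\<exists>N. ?P 0 N" by (intro exI[of _ 0]) auto
  next
    fix N k
    assume "?P k N"
    then show "\<exists>N'. ?P (Suc k) N' \<and> N \<le> N'"
      by (metis sibuya_diff_sign_step[OF \<beta>, of N k])
  qed
  then obtain N where "\<And>k. ?P k (N k)" "\<And>k. N k \<le> N (Suc k)" by blast
  then show thesis
    by (intro that[of N]) (auto intro: lift_Suc_mono_le simp: mono_def)
qed

lemma sum_abs_le_one_sign_change:
  fixes s :: "nat \<Rightarrow> real"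
  assumes sign: "\<And>j k. \<not> Q k \<Longrightarrow> k \<le> j \<Longrightarrow> \<not> Q j"
    and pos: "\<And>k. Q k \<Longrightarrow> 0 \<le> s k" and neg: "\<And>k. \<not> Q k \<Longrightarrow> s k \<le> 0"
    and nonneg: "\<And>m. 0 \<le> (\<Sum>k<m. s k)" and bound: "\<And>m. (\<Sum>k<m. s k) \<le> M"
  shows "(\<Sum>k<m. \<bar>s k\<bar>) \<le> 2 * M"
proof -
  \<comment> \<open>\<open>l\<close> marks the sign change, cut off at \<open>m\<close>. The last
    conjunct carries the induction: while \<open>Q\<close> holds, no negative term has
    occurred.\<close>
  have "\<exists>l\<le>m. (\<Sum>k<m. \<bar>s k\<bar>) = 2 * (\<Sum>k<l. s k) - (\<Sum>k<m. s k) \<and> (\<not> Q m \<or> l = m)"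
  proof (induction m)
    case (Suc m)
    then obtain l where l: "l \<le> m" "(\<Sum>k<m. \<bar>s k\<bar>) = 2 * (\<Sum>k<l. s k) - (\<Sum>k<m. s k)"
      "\<not> Q m \<or> l = m" by blast
    show ?case
    proof (cases "Q m")
      case True
      then show ?thesis using l pos[OF True] by (intro exI[of _ "Suc m"]) auto
    next
      case False
      then show ?thesis using l neg[OF False] sign[of m "Suc m"] by (intro exI[of _ l]) auto
    qed
  qed simp
  then obtain l where "(\<Sum>k<m. \<bar>s k\<bar>) = 2 * (\<Sum>k<l. s k) - (\<Sum>k<m. s k)" by blast
  then show ?thesis using bound[of l] nonneg[of m] by linarith
qed

text \<open>For fixed \<open>n\<close>, the set of \<open>k\<close> with threshold at most
  \<open>n\<close> is an initial segment, so the differences change sign once; their partial sums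
  are given by \<open>sum_sibuya_diff\<close>.\<close>

lemma sum_abs_sibuya_diff_le:
  assumes \<beta>: "0 < \<beta>" "\<beta> < 1"
    and C: "\<And>k. real k * sibuya_pow \<beta> (Suc n) k \<le> C"
  shows "(\<Sum>k<m. \<bar>sibuya_diff \<beta> n k\<bar>) \<le> 2 * (C / (real (Suc n) * \<beta>))"
proof -
  obtain N :: "nat \<Rightarrow> nat" where N: "mono N"
    "\<And>n k. n < N k \<Longrightarrow> sibuya_diff \<beta> n k \<le> 0" "\<And>n k. N k \<le> n \<Longrightarrow> 0 \<le> sibuya_diff \<beta> n k"
    using sibuya_diff_sign[OF \<beta>] by blast
  have eq: "(\<Sum>k<m. sibuya_diff \<beta> n k) = real m * sibuya_pow \<beta> (Suc n) m / (real (Suc n) * \<beta>)" for m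
    using sum_sibuya_diff[of n \<beta> m] \<beta> by (simp add: eq_divide_eq mult.commute del: power_Suc of_nat_Suc)
  have nonneg: "0 \<le> sibuya_pow \<beta> (Suc n) m" for m
    using \<beta> by (intro fps_power_nonneg) (simp add: A_fun_nonneg)
  show ?thesis
  proof (rule sum_abs_le_one_sign_change[where Q = "\<lambda>k. N k \<le> n"])
    fix j k
    assume "\<not> N k \<le> n" "k \<le> j"
    then show "\<not> N j \<le> n" using monoD[OF N(1), of k j] by linarith
  next
    fix m
    show "0 \<le> (\<Sum>k<m. sibuya_diff \<beta> n k)"
      unfolding eq using nonneg[of m] \<beta> by (intro divide_nonneg_nonneg mult_nonneg_nonneg) auto
    show "(\<Sum>k<m. sibuya_diff \<beta> n k) \<le> C / (real (Suc n) * \<beta>)"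
      unfolding eq using C[of m] \<beta> by (intro divide_right_mono) auto
  qed (use N in auto)
qed

section \<open>Uniform bounds for the convolution powers\<close>

text \<open>A sum of \<open>n\<close> nonnegative variables is at most \<open>k\<close> only if each
  one is; then (1 - t)^n \<le> exp(-nt), with t the tail.\<close>

lemma sum_sibuya_pow_le:
  assumes "0 < \<beta>" "\<beta> < 1"
  shows "(\<Sum>j\<le>k. sibuya_pow \<beta> n j) \<le> exp (- real n * (1 - \<beta>) * real (Suc k) powr - \<beta>)"
proof -
  have "(\<Sum>j\<le>k. sibuya_pow \<beta> n j) \<le> (1 - sibuya_tail \<beta> k) ^ n"
    using sum_fps_power_le[of "sibuya \<beta>" n k] assms by (simp add: A_fun_nonneg sum_A_fun)
  also have "\<dots> \<le> exp (- sibuya_tail \<beta> k) ^ n"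
    using exp_ge_add_one_self[of "- sibuya_tail \<beta> k"] sibuya_tail_le[of \<beta> k] assms
      powr_mono[of "- \<beta>" 0 "real (Suc k)"]
    by (intro power_mono) auto
  also have "\<dots> = exp (- real n * sibuya_tail \<beta> k)"
    by (simp add: exp_of_nat_mult[symmetric])
  also have "\<dots> \<le> exp (- real n * (1 - \<beta>) * real (Suc k) powr - \<beta>)"
    using mult_left_mono[OF sibuya_tail_ge[of \<beta> k], of "real n"] assms by simp
  finally show ?thesis .
qed

text \<open>At distances up to \<open>J\<close> the local bound is summed against i^(-\<beta>);
  beyond \<open>J\<close> the tail is at most J^(-\<beta>) and the mass bound applies. With J = Q/m
  both parts are multiples of m^\<beta> Q^(1-\<beta>).\<close>

lemma sum_sibuya_pow_tail_le:
  assumes \<beta>: "0 < \<beta>" "\<beta> < 1" and "0 < m" "0 < Q"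
    and m: "\<And>j. sibuya_pow \<beta> n j \<le> m" and Q: "(\<Sum>j\<le>k. sibuya_pow \<beta> n j) \<le> Q"
  shows "(\<Sum>j\<le>k. sibuya_pow \<beta> n j * sibuya_tail \<beta> (k - j)) \<le>
    (1 / (1 - \<beta>) + 1) * m powr \<beta> * Q powr (1 - \<beta>)"
proof -
  \<comment> \<open>the cut-off that balances the local bound \<open>m\<close> against the mass bound \<open>Q\<close>\<close>
  define J where "J = Q / m"
  define h where "h i = (if real (Suc i) \<le> J then real (Suc i) powr - \<beta> else 0)" for i
  have J: "0 < J" using assms by (simp add: J_def)
  have nonneg: "0 \<le> sibuya_pow \<beta> n j" for j
    using \<beta> by (intro fps_power_nonneg) (simp add: A_fun_nonneg)
  have "sibuya_pow \<beta> n j * sibuya_tail \<beta> (k - j) \<le> m * h (k - j) + sibuya_pow \<beta> n j * J powr - \<beta>" for j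
  proof -
    have t: "sibuya_tail \<beta> (k - j) \<le> real (Suc (k - j)) powr - \<beta>"
      using \<beta> by (intro sibuya_tail_le) auto
    show ?thesis
    proof (cases "real (Suc (k - j)) \<le> J")
      case True
      have "sibuya_pow \<beta> n j * sibuya_tail \<beta> (k - j) \<le> m * real (Suc (k - j)) powr - \<beta>"
        using t m[of j] \<open>0 < m\<close> \<beta> by (intro mult_mono sibuya_tail_nonneg) auto
      moreover have "0 \<le> sibuya_pow \<beta> n j * J powr - \<beta>" using nonneg by simp
      ultimately show ?thesis using True by (simp add: h_def)
    next
      case False
      then have "real (Suc (k - j)) powr - \<beta> \<le> J powr - \<beta>"
        using J \<beta> by (intro powr_mono2') auto
      then have "sibuya_pow \<beta> n j * sibuya_tail \<beta> (k - j) \<le> sibuya_pow \<beta> n j * J powr - \<beta>"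
        using t nonneg by (intro mult_left_mono) auto
      then show ?thesis using False by (simp add: h_def)
    qed
  qed
  then have "(\<Sum>j\<le>k. sibuya_pow \<beta> n j * sibuya_tail \<beta> (k - j)) \<le>
      (\<Sum>j\<le>k. m * h (k - j) + sibuya_pow \<beta> n j * J powr - \<beta>)"
    by (intro sum_mono) auto
  also have "\<dots> = m * (\<Sum>j\<le>k. h j) + (\<Sum>j\<le>k. sibuya_pow \<beta> n j) * J powr - \<beta>"
    using sum.atLeastAtMost_rev[of h 0 k]
    by (simp add: sum.distrib sum_distrib_left[symmetric] sum_distrib_right[symmetric] atLeast0AtMost)
  also have "\<dots> \<le> m * (J powr (1 - \<beta>) / (1 - \<beta>)) + Q * J powr - \<beta>"
  proof (intro add_mono mult_left_mono mult_right_mono Q)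
    have "(\<Sum>j\<le>k. h j) = (\<Sum>j\<in>{j. j \<le> k \<and> real (Suc j) \<le> J}. real (Suc j) powr - \<beta>)"
      by (auto simp: h_def sum.If_cases intro!: sum.cong)
    also have "\<dots> \<le> (\<Sum>j<nat \<lfloor>J\<rfloor>. real (Suc j) powr - \<beta>)"
      by (intro sum_mono2) (auto simp: Suc_le_eq[symmetric] le_nat_floor)
    also have "\<dots> \<le> real (nat \<lfloor>J\<rfloor>) powr (1 - \<beta>) / (1 - \<beta>)"
      using \<beta> by (intro sum_powr_neg_le) auto
    also have "\<dots> \<le> J powr (1 - \<beta>) / (1 - \<beta>)"
      using \<beta> J by (intro divide_right_mono powr_mono2) auto
    finally show "(\<Sum>j\<le>k. h j) \<le> J powr (1 - \<beta>) / (1 - \<beta>)" .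
  qed (use assms in auto)
  also have "m * (J powr (1 - \<beta>) / (1 - \<beta>)) = 1 / (1 - \<beta>) * m powr \<beta> * Q powr (1 - \<beta>)"
    using assms by (simp add: J_def powr_divide powr_diff powr_minus field_simps)
  also have "Q * J powr - \<beta> = m powr \<beta> * Q powr (1 - \<beta>)"
    using assms by (simp add: J_def powr_divide powr_diff powr_minus field_simps)
  finally show ?thesis by (simp add: algebra_simps)
qed

text \<open>The local bound m = D n^(-1/\<beta>) has m^\<beta> = D^\<beta>/n, which cancels the
  factor n + 1 up to 2. In the exponent, one factor 1 - \<beta> comes from the mass bound, the other
  from the power Q^(1-\<beta>), and 1/2 from n \<ge> (n+1)/2.\<close>

lemma sibuya_pow_step:
  assumes \<beta>: "0 < \<beta>" "\<beta> < 1" and "1 \<le> n" "0 < D"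
    and D: "\<And>j. sibuya_pow \<beta> n j \<le> D * real n powr - (1 / \<beta>)"
  shows "real (Suc k) * sibuya_pow \<beta> (Suc n) (Suc k) \<le>
    2 * (1 / (1 - \<beta>) + 1) * D powr \<beta> * exp (- ((1 - \<beta>)\<^sup>2 / 2 * (real (Suc n) * real (Suc k) powr - \<beta>)))"
proof -
  define Q where "Q = exp (- real n * (1 - \<beta>) * real (Suc k) powr - \<beta>)"
  define m where "m = D * real n powr - (1 / \<beta>)"
  define c where "c = 1 / (1 - \<beta>) + 1"
  have c: "0 < c" using \<beta> by (simp add: c_def add_pos_pos)
  have m: "0 < m" "m powr \<beta> = D powr \<beta> / real n"
    using assms(1-4) by (auto simp: m_def powr_mult powr_divide powr_powr powr_minus_divide)
  have "real (Suc k) * sibuya_pow \<beta> (Suc n) (Suc k) \<le>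
      real (Suc n) * \<beta> * (c * m powr \<beta> * Q powr (1 - \<beta>))"
    unfolding sibuya_pow_Suc_Suc c_def
    using \<beta> m D sum_sibuya_pow_le[OF \<beta>, where n = n and k = k]
    by (intro mult_left_mono sum_sibuya_pow_tail_le) (auto simp: Q_def m_def)
  also have "\<dots> = (real (Suc n) / real n * \<beta>) * (c * D powr \<beta> * Q powr (1 - \<beta>))"
    using m by simp
  also have "\<dots> \<le> 2 * (c * D powr \<beta> * Q powr (1 - \<beta>))"
  proof (rule mult_right_mono)
    have "real (Suc n) / real n * \<beta> \<le> 2 * 1"
      using \<open>1 \<le> n\<close> \<beta> by (intro mult_mono) (auto simp: field_simps)
    then show "real (Suc n) / real n * \<beta> \<le> 2" by simp
  qed (use c in auto)
  also have "\<dots> \<le> 2 * (c * D powr \<beta> * exp (- ((1 - \<beta>)\<^sup>2 / 2 * (real (Suc n) * real (Suc k) powr - \<beta>))))"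
  proof (intro mult_left_mono)
    have "real (Suc n) / 2 \<le> real n" using \<open>1 \<le> n\<close> by simp
    then have "real (Suc n) / 2 * ((1 - \<beta>)\<^sup>2 * real (Suc k) powr - \<beta>)
        \<le> real n * ((1 - \<beta>)\<^sup>2 * real (Suc k) powr - \<beta>)"
      by (intro mult_right_mono) auto
    then show "Q powr (1 - \<beta>) \<le> exp (- ((1 - \<beta>)\<^sup>2 / 2 * (real (Suc n) * real (Suc k) powr - \<beta>)))"
      by (simp add: Q_def exp_powr_real power2_eq_square mult_ac)
  qed (use c in auto)
  finally show ?thesis by (simp only: c_def mult.assoc)
qed

lemma sibuya_pow_local_bound:
  assumes \<beta>: "0 < \<beta>" "\<beta> < 1"
  obtains D where "0 < D" "\<And>n j. 1 \<le> n \<Longrightarrow> sibuya_pow \<beta> n j \<le> D * real n powr - (1 / \<beta>)"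
proof -
  define c1 where "c1 = 2 * (1 / (1 - \<beta>) + 1)"
  define c where "c = (1 - \<beta>)\<^sup>2 / 2"
  define c2 where "c2 = (1 / \<beta> / c) powr (1 / \<beta>)"
  \<comment> \<open>One step turns the constant \<open>D\<close> into \<open>c1 * c2 * D powr \<beta>\<close>, which is at most \<open>D\<close> for large \<open>D\<close>.\<close>
  define D where "D = max 1 ((c1 * c2) powr (1 / (1 - \<beta>)))"
  have c: "0 < c1" "0 < c" "0 \<le> c2" using \<beta> by (auto simp: c1_def c_def c2_def add_pos_pos)
  have D: "1 \<le> D" by (simp add: D_def)
  have "c1 * c2 \<le> D powr (1 - \<beta>)"
  proof -
    have "c1 * c2 = ((c1 * c2) powr (1 / (1 - \<beta>))) powr (1 - \<beta>)"
      using c \<beta> by (simp add: powr_powr)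
    also have "\<dots> \<le> D powr (1 - \<beta>)"
      using \<beta> by (intro powr_mono2) (auto simp: D_def)
    finally show ?thesis .
  qed
  then have "c1 * c2 * D powr \<beta> \<le> D powr (1 - \<beta>) * D powr \<beta>"
    by (intro mult_right_mono) auto
  then have D_ineq: "c1 * c2 * D powr \<beta> \<le> D"
    using D by (simp add: powr_add[symmetric])
  have "sibuya_pow \<beta> n j \<le> D * real n powr - (1 / \<beta>)" if "1 \<le> n" for n j
    using that
  proof (induction n arbitrary: j rule: nat_induct_at_least)
    case base
    have "A_fun \<beta> (int j) \<le> (\<Sum>k\<le>j. A_fun \<beta> (int k))"
      using \<beta> by (intro member_le_sum) (auto intro!: A_fun_nonneg)
    also have "\<dots> \<le> D"
      using \<beta> D sibuya_tail_nonneg[of \<beta> j] by (simp add: sum_A_fun)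
    finally show ?case by simp
  next
    case (Suc n)
    show ?case
    proof (cases j)
      case 0
      then show ?thesis using D by simp
    next
      case (Suc k)
      \<comment> \<open>In this scale 1/(k+1) is x^(1/\<beta>) (n+1)^(-1/\<beta>), and the
        exponential absorbs the power of \<open>x\<close>.\<close>
      define x where "x = real (Suc n) * real (Suc k) powr - \<beta>"
      have x: "0 \<le> x" "x powr (1 / \<beta>) = real (Suc n) powr (1 / \<beta>) / real (Suc k)"
        using \<beta> by (auto simp: x_def powr_mult powr_divide powr_powr powr_minus_divide)
      have "real (Suc k) * sibuya_pow \<beta> (Suc n) j \<le> c1 * D powr \<beta> * exp (- (c * x))"
        unfolding c1_def c_def x_def Suc
        using Suc.IH Suc.hyps D \<beta> by (intro sibuya_pow_step) auto
      then have "sibuya_pow \<beta> (Suc n) j \<le> c1 * D powr \<beta> * exp (- (c * x)) / real (Suc k)"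
        by (simp add: pos_le_divide_eq mult.commute del: power_Suc)
      also have "\<dots> = c1 * D powr \<beta> * (x powr (1 / \<beta>) * exp (- c * x)) * real (Suc n) powr - (1 / \<beta>)"
        by (simp add: x powr_minus)
      also have "\<dots> \<le> c1 * D powr \<beta> * c2 * real (Suc n) powr - (1 / \<beta>)"
        unfolding c2_def using c x \<beta> by (intro mult_right_mono mult_left_mono powr_le_exp) auto
      also have "\<dots> \<le> D * real (Suc n) powr - (1 / \<beta>)"
        using D_ineq by (intro mult_right_mono) (auto simp: mult_ac)
      finally show ?thesis .
    qed
  qed
  with D show thesis by (intro that[of D]) auto
qed

text \<open>The step estimate with its exponential dropped; it needs a predecessor of
  \<open>n\<close> that is at least 1.\<close>

lemma sibuya_pow_weighted_bound:
  assumes \<beta>: "0 < \<beta>" "\<beta> < 1"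
  obtains C where "\<And>n k. 2 \<le> n \<Longrightarrow> real k * sibuya_pow \<beta> n k \<le> C"
proof -
  obtain D where D: "0 < D" "\<And>n j. 1 \<le> n \<Longrightarrow> sibuya_pow \<beta> n j \<le> D * real n powr - (1 / \<beta>)"
    using sibuya_pow_local_bound[OF \<beta>] by blast
  define C where "C = 2 * (1 / (1 - \<beta>) + 1) * D powr \<beta>"
  have C: "0 \<le> C" using \<beta> by (simp add: C_def)
  have "real k * sibuya_pow \<beta> n k \<le> C" if n: "2 \<le> n" for n k
  proof (cases k)
    case (Suc j)
    obtain m where m: "n = Suc m" "1 \<le> m" using n by (cases n) auto
    have "real k * sibuya_pow \<beta> n k \<le>
        C * exp (- ((1 - \<beta>)\<^sup>2 / 2 * (real (Suc m) * real (Suc j) powr - \<beta>)))"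
      unfolding C_def Suc m(1) using \<beta> D m(2) by (intro sibuya_pow_step) auto
    also have "\<dots> \<le> C"
      using C by (intro mult_left_le) (auto simp: zero_le_mult_iff)
    finally show ?thesis .
  qed (use C in simp)
  then show thesis using that by blast
qed

section \<open>Convolution and subordination as operations on power series\<close>

lemma conv_eq_fps:
  assumes "\<And>k. k < 0 \<Longrightarrow> F k = 0" "\<And>k. k < 0 \<Longrightarrow> G k = 0"
  shows "conv F G k = (if k < 0 then 0 else fps_nth (seq_fps F * seq_fps G) (nat k))"
proof (cases "k < 0")
  case True
  then have "F j * G (k - j) = 0" for j
    using assms(1)[of j] assms(2)[of "k - j"] by (cases "j < 0") auto
  then show ?thesis unfolding conv_def using True by (simp only: infsum_0 if_True)
next
  case False
  have "conv F G k = (\<Sum>\<^sub>\<infinity>j\<in>int ` {0..nat k}. F j * G (k - j))"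
    unfolding conv_def
  proof (rule infsum_cong_neutral)
    fix j
    assume "j \<in> UNIV - int ` {0..nat k}"
    then have "j < 0 \<or> k - j < 0"
      using False by (cases "j < 0") (auto simp: image_iff Ball_def dest: spec[of _ "nat j"])
    then show "F j * G (k - j) = 0" using assms by auto
  qed auto
  also have "\<dots> = (\<Sum>j\<in>int ` {0..nat k}. F j * G (k - j))" by simp
  also have "\<dots> = (\<Sum>j = 0..nat k. F (int j) * G (int (nat k - j)))"
    using False by (subst sum.reindex) (auto simp: of_nat_diff intro!: sum.cong)
  finally show ?thesis using False by (simp add: fps_mult_nth)
qed

lemma conv_pow_eq_fps:
  assumes "\<And>k. k < 0 \<Longrightarrow> F k = 0"
  shows "conv_pow F n k = (if k < 0 then 0 else fps_nth (seq_fps F ^ n) (nat k))"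
proof (induction n arbitrary: k)
  case (Suc n)
  have "seq_fps (conv_pow F n) = seq_fps F ^ n"
    by (rule fps_ext) (simp add: Suc.IH)
  then show ?case
    using conv_eq_fps[of F "conv_pow F n" k] assms Suc.IH by simp
qed auto

lemma sums_fps_power:
  fixes g :: "real fps"
  assumes "\<And>k. 0 \<le> fps_nth g k" "fps_nth g sums 1"
  shows "fps_nth (g ^ n) sums 1"
proof (induction n)
  case 0
  show ?case using sums_single[of 0 "\<lambda>_. 1::real"] by (simp add: fps_one_nth[abs_def])
next
  case (Suc n)
  have "(\<lambda>k. \<Sum>i\<le>k. fps_nth g i * fps_nth (g ^ n) (k - i)) sums
      ((\<Sum>k. fps_nth g k) * (\<Sum>k. fps_nth (g ^ n) k))"
    using assms Suc.IH fps_power_nonneg[of g]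
    by (intro Cauchy_product_sums) (auto simp: sums_iff)
  then show ?case
    using assms Suc.IH by (simp add: sums_iff fps_mult_nth atLeast0AtMost cong: suminf_cong)
qed

text \<open>Every power of \<open>g\<close> has total mass 1, so swapping the sums gives the l1
  contraction. The truncated form requires no summability of \<open>u\<close>.\<close>

lemma sum_abs_fps_compose_le:
  fixes u g :: "real fps"
  assumes g: "\<And>k. 0 \<le> fps_nth g k" "fps_nth g sums 1"
  shows "(\<Sum>m\<le>n. \<bar>fps_nth (fps_compose u g) m\<bar>) \<le> (\<Sum>k\<le>n. \<bar>fps_nth u k\<bar>)"
proof -
  note nonneg = fps_power_nonneg[OF g(1)]
  have "\<bar>fps_nth (fps_compose u g) m\<bar> \<le> (\<Sum>k\<le>n. \<bar>fps_nth u k\<bar> * fps_nth (g ^ k) m)" if "m \<le> n" for m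
  proof -
    have "\<bar>fps_nth (fps_compose u g) m\<bar> \<le> (\<Sum>k\<le>m. \<bar>fps_nth u k\<bar> * fps_nth (g ^ k) m)"
      unfolding fps_compose_nth atLeast0AtMost
      using nonneg by (intro order_trans[OF sum_abs]) (simp add: abs_mult)
    also have "\<dots> \<le> (\<Sum>k\<le>n. \<bar>fps_nth u k\<bar> * fps_nth (g ^ k) m)"
      using that nonneg by (intro sum_mono2) auto
    finally show ?thesis .
  qed
  then have "(\<Sum>m\<le>n. \<bar>fps_nth (fps_compose u g) m\<bar>) \<le>
      (\<Sum>m\<le>n. \<Sum>k\<le>n. \<bar>fps_nth u k\<bar> * fps_nth (g ^ k) m)"
    by (intro sum_mono) auto
  also have "\<dots> = (\<Sum>k\<le>n. \<bar>fps_nth u k\<bar> * (\<Sum>m\<le>n. fps_nth (g ^ k) m))"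
    by (subst sum.swap) (simp add: sum_distrib_left)
  also have "\<dots> \<le> (\<Sum>k\<le>n. \<bar>fps_nth u k\<bar> * 1)"
  proof (intro sum_mono mult_left_mono)
    fix k
    show "(\<Sum>m\<le>n. fps_nth (g ^ k) m) \<le> 1"
      using sum_le_suminf[of "fps_nth (g ^ k)" "{..n}"] sums_fps_power[OF g] nonneg
      by (auto simp: sums_iff)
  qed auto
  finally show ?thesis by simp
qed

lemma fps_compose_nonneg:
  fixes f g :: "real fps"
  assumes "\<And>k. 0 \<le> fps_nth f k" "\<And>k. 0 \<le> fps_nth g k"
  shows "0 \<le> fps_nth (fps_compose f g) k"
  unfolding fps_compose_nth using assms fps_power_nonneg[of g] by (intro sum_nonneg) auto

lemma sums_fps_compose:
  fixes f g :: "real fps"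
  assumes f: "\<And>k. 0 \<le> fps_nth f k" "fps_nth f sums 1"
    and g: "\<And>k. 0 \<le> fps_nth g k" "fps_nth g sums 1" "fps_nth g 0 = 0"
  shows "fps_nth (fps_compose f g) sums 1"
proof -
  note nonneg = fps_compose_nonneg[OF f(1) g(1)]
  have le: "(\<Sum>m\<le>n. fps_nth (fps_compose f g) m) \<le> 1" for n
  proof -
    have "(\<Sum>m\<le>n. fps_nth (fps_compose f g) m) \<le> (\<Sum>m\<le>n. fps_nth f m)"
      using sum_abs_fps_compose_le[OF g(1,2), of f n] nonneg f by simp
    also have "\<dots> \<le> 1"
      using sum_le_suminf[of "fps_nth f" "{..n}"] f by (auto simp: sums_iff)
    finally show ?thesis .
  qed
  have summable: "summable (fps_nth (fps_compose f g))"
    using nonneg le by (intro bounded_imp_summable) auto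
  \<comment> \<open>The lower bound on the mass: truncate the outer series at \<open>n\<close>. As
    \<open>g\<close> has no constant term, powers beyond \<open>m\<close> do not reach coefficient
    \<open>m\<close>.\<close>
  have "(\<Sum>k\<le>n. fps_nth f k) \<le> suminf (fps_nth (fps_compose f g))" for n
  proof (rule sums_le)
    show "(\<lambda>m. \<Sum>k\<le>n. fps_nth f k * fps_nth (g ^ k) m) sums (\<Sum>k\<le>n. fps_nth f k)"
      using sums_sum[of "{..n}" "\<lambda>k m. fps_nth f k * fps_nth (g ^ k) m" "\<lambda>k. fps_nth f k * 1"]
        sums_mult[OF sums_fps_power[OF g(1,2)]] by simp
    show "fps_nth (fps_compose f g) sums suminf (fps_nth (fps_compose f g))"
      using summable by (rule summable_sums)
    fix m
    have "(\<Sum>k\<le>n. fps_nth f k * fps_nth (g ^ k) m) \<le>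
        (\<Sum>k\<in>{..n} \<union> {..m}. fps_nth f k * fps_nth (g ^ k) m)"
      using f g fps_power_nonneg[of g] by (intro sum_mono2) auto
    also have "\<dots> = (\<Sum>k\<le>m. fps_nth f k * fps_nth (g ^ k) m)"
      using startsby_zero_power_prefix[OF g(3)] by (intro sum.mono_neutral_right) auto
    finally show "(\<Sum>k\<le>n. fps_nth f k * fps_nth (g ^ k) m) \<le> fps_nth (fps_compose f g) m"
      by (simp add: fps_compose_nth atLeast0AtMost)
  qed
  moreover have "(\<lambda>n. \<Sum>k\<le>n. fps_nth f k) \<longlonglongrightarrow> 1"
    using f(2) by (simp add: sums_def_le)
  ultimately have "1 \<le> suminf (fps_nth (fps_compose f g))"
    by (intro LIMSEQ_le_const2) auto
  moreover have "suminf (fps_nth (fps_compose f g)) \<le> 1"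
    using summable_LIMSEQ'[OF summable] le by (intro LIMSEQ_le_const2) auto
  ultimately show ?thesis using summable by (simp add: sums_iff)
qed

section \<open>Probabilities on the integers and their Fourier transforms\<close>

lemma has_sum_int_iff_nat:
  fixes F :: "int \<Rightarrow> real"
  assumes "\<And>k. k < 0 \<Longrightarrow> F k = 0"
  shows "(F has_sum s) UNIV \<longleftrightarrow> ((\<lambda>n. F (int n)) has_sum s) UNIV"
proof -
  have "(F has_sum s) UNIV \<longleftrightarrow> (F has_sum s) (range int)"
    using assms by (intro has_sum_cong_neutral) (auto simp: image_iff, metis nonneg_int_cases not_le)
  also have "\<dots> \<longleftrightarrow> ((\<lambda>n. F (int n)) has_sum s) UNIV"
    by (subst has_sum_reindex) (auto simp: o_def)
  finally show ?thesis .
qed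

lemma prob_ZplusI:
  assumes "\<And>k. k < 0 \<Longrightarrow> F k = 0" "\<And>n. 0 \<le> F (int n)" "(\<lambda>n. F (int n)) sums 1"
  shows "F \<in> prob_Zplus"
proof -
  have "F (int n) \<le> 1" for n
    using sum_le_suminf[of "\<lambda>n. F (int n)" "{n}"] assms by (auto simp: sums_iff)
  then have "0 \<le> F k \<and> F k \<le> 1" for k
    using assms(1)[of k] assms(2) by (cases "k < 0") (auto simp: not_less dest!: zero_le_imp_eq_int)
  moreover have "(F has_sum 1) UNIV"
    using sums_nonneg_imp_has_sum[OF assms(3,2)] has_sum_int_iff_nat[of F 1] assms(1) by blast
  ultimately show ?thesis using assms(1) by (simp add: prob_Zplus_def)
qed

lemma infsum_int_le:
  fixes h :: "int \<Rightarrow> real"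
  assumes zero: "\<And>k. k < 0 \<Longrightarrow> h k = 0" and nonneg: "\<And>n. 0 \<le> h (int n)"
    and le: "\<And>n. (\<Sum>m\<le>n. h (int m)) \<le> K"
  shows "h summable_on UNIV" "infsum h UNIV \<le> K"
proof -
  have "summable (\<lambda>n. h (int n))"
    using nonneg le by (intro bounded_imp_summable) auto
  then have "((\<lambda>n. h (int n)) has_sum (\<Sum>n. h (int n))) UNIV"
    using nonneg by (intro sums_nonneg_imp_has_sum summable_sums)
  then have "(h has_sum (\<Sum>n. h (int n))) UNIV"
    by (simp only: has_sum_int_iff_nat[OF zero])
  moreover have "(\<Sum>n. h (int n)) \<le> K"
    using summable_LIMSEQ'[OF \<open>summable _\<close>] le by (intro LIMSEQ_le_const2) auto
  ultimately show "h summable_on UNIV" "infsum h UNIV \<le> K"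
    by (auto simp: has_sum_iff)
qed

text \<open>The real part is the sum of F(k)(1 - cos k\<xi>), with nonnegative terms. It is bounded
  below by the block N \<le> k < 2N with N about 1/|\<xi>|, where 1 \<le> k|\<xi>| \<le> 3 <
  pi.\<close>

lemma cmod_one_minus_fourier_ge:
  assumes F: "F \<in> prob_Zplus" and "0 < c"
    and ge: "\<And>k. 1 \<le> k \<Longrightarrow> c * real k powr - (1 + \<delta>) \<le> F (int k)"
    and \<delta>: "0 \<le> \<delta>" and \<xi>: "0 < \<bar>\<xi>\<bar>" "\<bar>\<xi>\<bar> \<le> 1 / 2"
  shows "(1 - cos 1) * c / 2 * (4 / \<bar>\<xi>\<bar>) powr - \<delta> \<le> cmod (1 - fourier F \<xi>)"
proof -
  define x where "x = \<bar>\<xi>\<bar>"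
  define g where "g k = complex_of_real (F k) * exp (- \<i> * of_int k * of_real \<xi>)" for k
  have nonneg: "0 \<le> F k" for k using F by (simp add: prob_Zplus_def)
  have sum1: "(F has_sum 1) UNIV" using F by (simp add: prob_Zplus_def)
  have Fx: "fourier F \<xi> = infsum g UNIV" unfolding fourier_def g_def ..
  have "norm (exp (- \<i> * of_int k * complex_of_real \<xi>)) = 1" for k :: int
    by (simp add: norm_exp_eq_Re)
  then have "norm (g k) = F k" for k
    unfolding g_def norm_mult using nonneg by simp
  then have "g summable_on UNIV"
    using abs_summable_summable[of g UNIV] has_sum_imp_summable[OF sum1] by simp
  then have "(g has_sum fourier F \<xi>) UNIV" by (simp add: Fx)
  then have "((\<lambda>k. Re (g k)) has_sum Re (fourier F \<xi>)) UNIV" by (rule has_sum_Re)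
  moreover have "Re (g k) = F k * cos (of_int k * x)" for k
    by (auto simp: g_def Re_exp x_def abs_if)
  ultimately have "((\<lambda>k. F k + - (F k * cos (of_int k * x))) has_sum (1 + - Re (fourier F \<xi>))) UNIV"
    using sum1 by (intro has_sum_add) (simp_all add: has_sum_uminus)
  then have hs: "((\<lambda>k. F k * (1 - cos (of_int k * x))) has_sum Re (1 - fourier F \<xi>)) UNIV"
    by (simp add: algebra_simps)
  define N where "N = nat \<lceil>1 / x\<rceil>"
  have x: "0 < x" "x \<le> 1 / 2" using \<xi> by (auto simp: x_def)
  have N: "1 / x \<le> real N" "real N \<le> 1 / x + 1" "1 \<le> N"
    using x by (auto simp: N_def real_nat_ceiling_ge) (linarith | simp add: Suc_le_eq)+
  have N2: "1 \<le> real N * x" "real N * x \<le> 3 / 2"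
    using N x by (auto simp: field_simps)
  \<comment> \<open>There are N terms, each at least a multiple of (2N)^(-1-\<delta>), whence the
    factor 1/2; and 2N \<le> 3/x \<le> 4/x.\<close>
  have "(1 - cos 1) * c / 2 * (4 / x) powr - \<delta> \<le> (1 - cos 1) * c / 2 * real (2 * N) powr - \<delta>"
    using N N2 x \<delta> \<open>0 < c\<close> by (intro mult_left_mono powr_mono2') (auto simp: pos_le_divide_eq mult.commute)
  also have "\<dots> = (\<Sum>k\<in>int ` {N..<2 * N}. c * real (2 * N) powr - (1 + \<delta>) * (1 - cos 1))"
  proof -
    have "real (2 * N) powr - (1 + \<delta>) = real (2 * N) powr - \<delta> / (2 * real N)"
    proof -
      have "- (1 + \<delta>) = - \<delta> - 1" by simp
      then show ?thesis using N by (simp only: powr_diff) simp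
    qed
    then show ?thesis using N by (simp add: card_image)
  qed
  also have "\<dots> \<le> (\<Sum>k\<in>int ` {N..<2 * N}. F k * (1 - cos (of_int k * x)))"
  proof (rule sum_mono)
    fix j
    assume "j \<in> int ` {N..<2 * N}"
    then obtain k where k: "j = int k" "N \<le> k" "k < 2 * N" by auto
    have kx: "1 \<le> real k * x" "real k * x \<le> 3"
    proof -
      have "real N * x \<le> real k * x" "real k * x \<le> real (2 * N) * x"
        using k x by (intro mult_right_mono; linarith)+
      then show "1 \<le> real k * x" "real k * x \<le> 3" using N2 by auto
    qed
    have "c * real (2 * N) powr - (1 + \<delta>) \<le> c * real k powr - (1 + \<delta>)"
      using k N \<open>0 < c\<close> \<delta> by (intro mult_left_mono powr_mono2') auto
    also have "\<dots> \<le> F j" using ge[of k] k N by simp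
    finally have "c * real (2 * N) powr - (1 + \<delta>) \<le> F j" .
    moreover have "cos (real k * x) \<le> cos 1"
      using kx pi_gt3 by (intro cos_monotone_0_pi_le) linarith+
    ultimately show "c * real (2 * N) powr - (1 + \<delta>) * (1 - cos 1) \<le> F j * (1 - cos (of_int j * x))"
      unfolding k(1) of_int_of_nat_eq using nonneg[of "int k"] by (intro mult_mono) simp_all
  qed
  also have "\<dots> \<le> Re (1 - fourier F \<xi>)"
    using nonneg by (intro finite_sum_le_has_sum[OF hs]) auto
  also have "\<dots> \<le> cmod (1 - fourier F \<xi>)" by (rule complex_Re_le_cmod)
  finally show ?thesis by (simp add: x_def)
qed

lemma tendsto_powr_div_fourier:
  assumes F: "F \<in> prob_Zplus" and c: "0 < c"
    and ge: "\<And>k. 1 \<le> k \<Longrightarrow> c * real k powr - (1 + \<delta>) \<le> F (int k)"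
    and \<delta>: "0 \<le> \<delta>" "\<delta> < \<alpha>"
  shows "((\<lambda>\<xi>. \<bar>\<xi>\<bar> powr \<alpha> / cmod (1 - fourier F \<xi>)) \<longlongrightarrow> 0) (at 0)"
proof (rule Lim_null_comparison)
  define K where "K = (1 - cos 1) * c / 2 * 4 powr - \<delta>"
  have "cos 1 < (1::real)" using cos_monotone_0_pi[of 0 1] pi_gt3 by simp
  then have K: "0 < K" using c by (simp add: K_def)
  have "eventually (\<lambda>\<xi>::real. \<xi> \<noteq> 0 \<and> \<bar>\<xi>\<bar> \<le> 1 / 2) (at 0)"
    by (auto simp: eventually_at intro!: exI[of _ "1 / 2"])
  then show "\<forall>\<^sub>F \<xi> in at 0. norm (\<bar>\<xi>\<bar> powr \<alpha> / cmod (1 - fourier F \<xi>)) \<le> \<bar>\<xi>\<bar> powr (\<alpha> - \<delta>) / K"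
  proof eventually_elim
    case (elim \<xi>)
    have "K * \<bar>\<xi>\<bar> powr \<delta> \<le> cmod (1 - fourier F \<xi>)"
    proof -
      have "(4 / \<bar>\<xi>\<bar>) powr - \<delta> = 4 powr - \<delta> * \<bar>\<xi>\<bar> powr \<delta>"
        using elim by (simp add: powr_divide powr_minus_divide)
      then show ?thesis
        using cmod_one_minus_fourier_ge[OF F c ge \<delta>(1), of \<xi>] elim by (simp add: K_def mult.assoc)
    qed
    then have "\<bar>\<xi>\<bar> powr \<alpha> / cmod (1 - fourier F \<xi>) \<le> \<bar>\<xi>\<bar> powr \<alpha> / (K * \<bar>\<xi>\<bar> powr \<delta>)"
      using K elim less_le_trans[of 0 "K * \<bar>\<xi>\<bar> powr \<delta>" "cmod (1 - fourier F \<xi>)"]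
      by (intro divide_left_mono mult_pos_pos) auto
    then show ?case by (simp add: powr_diff mult.commute)
  qed
  have "((\<lambda>\<xi>::real. \<bar>\<xi>\<bar> powr (\<alpha> - \<delta>)) \<longlongrightarrow> 0) (at 0)"
    using \<delta> by (intro tendsto_zero_powrI[OF _ tendsto_const]) (auto intro!: tendsto_eq_intros)
  from tendsto_divide[OF this tendsto_const, of K]
  show "((\<lambda>\<xi>. \<bar>\<xi>\<bar> powr (\<alpha> - \<delta>) / K) \<longlongrightarrow> 0) (at 0)" using K by simp
qed

section \<open>The averaged distribution\<close>

lemma continuous_on_A_fun: "continuous_on S (\<lambda>\<alpha>. A_fun \<alpha> k)"
  unfolding A_fun_def by (cases "k \<le> 0") (auto intro!: continuous_intros)

lemma continuous_on_sibuya_tail: "continuous_on S (\<lambda>\<alpha>. sibuya_tail \<alpha> k)"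
  unfolding sibuya_tail_def by (auto intro!: continuous_intros)

lemma integrable_A_fun: "(\<lambda>\<alpha>. A_fun \<alpha> k) integrable_on {a..b}"
  by (intro integrable_continuous_interval continuous_on_A_fun)

lemma B_avg_nonpos: "k \<le> 0 \<Longrightarrow> B_avg \<epsilon> k = 0"
  by (simp add: B_avg_def)

lemma B_avg_nonneg:
  assumes "0 < \<epsilon>" "\<epsilon> \<le> 1"
  shows "0 \<le> B_avg \<epsilon> (int k)"
  unfolding B_avg_def using assms
  by (intro divide_nonneg_pos integral_nonneg integrable_A_fun A_fun_nonneg) auto

text \<open>The bound (n+1)^(-\<alpha>) on the tail is exponential in \<alpha> and integrates
  explicitly; \<open>1 \<le> n\<close> makes the logarithm positive.\<close>

lemma integral_sibuya_tail_le:
  assumes "0 < \<epsilon>" "\<epsilon> \<le> 1" "1 \<le> n"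
  shows "integral {0..\<epsilon>} (\<lambda>\<alpha>. sibuya_tail \<alpha> n) \<le> 1 / ln (real (Suc n))"
proof -
  define L where "L = ln (real (Suc n))"
  have L: "0 < L" using assms by (simp add: L_def)
  have "((\<lambda>\<alpha>. exp (- (\<alpha> * L))) has_integral (- exp (- (\<epsilon> * L)) / L) - (- exp (- (0 * L)) / L)) {0..\<epsilon>}"
    using assms L
    by (intro fundamental_theorem_of_calculus)
      (auto simp flip: has_real_derivative_iff_has_vector_derivative intro!: derivative_eq_intros)
  then have I: "((\<lambda>\<alpha>. exp (- (\<alpha> * L))) has_integral (1 - exp (- (\<epsilon> * L))) / L) {0..\<epsilon>}"
    by (simp add: diff_divide_distrib)
  have "integral {0..\<epsilon>} (\<lambda>\<alpha>. sibuya_tail \<alpha> n) \<le> integral {0..\<epsilon>} (\<lambda>\<alpha>. exp (- (\<alpha> * L)))"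
  proof (rule integral_le)
    fix \<alpha>
    assume "\<alpha> \<in> {0..\<epsilon>}"
    then show "sibuya_tail \<alpha> n \<le> exp (- (\<alpha> * L))"
      using sibuya_tail_le[of \<alpha> n] assms by (simp add: powr_def L_def)
  qed (use I in \<open>auto intro!: integrable_continuous_interval continuous_on_sibuya_tail continuous_intros\<close>)
  also have "\<dots> = (1 - exp (- (\<epsilon> * L))) / L" using I by (rule integral_unique)
  also have "\<dots> \<le> 1 / L" using L by (intro divide_right_mono) auto
  finally show ?thesis by (simp add: L_def)
qed

text \<open>Finite sums commute with the integral, so the mass missing after \<open>n\<close> terms
  is the averaged tail, which tends to 0.\<close>

lemma sums_B_avg:
  assumes "0 < \<epsilon>" "\<epsilon> \<le> 1"
  shows "(\<lambda>k. B_avg \<epsilon> (int k)) sums 1"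
proof -
  let ?I = "\<lambda>n. integral {0..\<epsilon>} (\<lambda>\<alpha>. sibuya_tail \<alpha> n)"
  have eq: "(\<Sum>k\<le>n. B_avg \<epsilon> (int k)) = 1 - ?I n / \<epsilon>" for n
  proof -
    have "(\<Sum>k\<le>n. B_avg \<epsilon> (int k)) = integral {0..\<epsilon>} (\<lambda>\<alpha>. \<Sum>k\<le>n. A_fun \<alpha> (int k)) / \<epsilon>"
      unfolding B_avg_def by (simp add: integral_sum integrable_A_fun sum_divide_distrib)
    also have "\<dots> = (integral {0..\<epsilon>} (\<lambda>\<alpha>. 1) - ?I n) / \<epsilon>"
      unfolding sum_A_fun
      by (subst integral_diff) (auto intro!: integrable_continuous_interval continuous_on_sibuya_tail)
    finally show ?thesis using assms by (simp add: diff_divide_distrib)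
  qed
  have "?I \<longlonglongrightarrow> 0"
  proof (rule tendsto_sandwich[OF _ _ tendsto_const])
    show "\<forall>\<^sub>F n in sequentially. 0 \<le> ?I n"
      using assms by (intro always_eventually allI integral_nonneg sibuya_tail_nonneg)
        (auto intro!: integrable_continuous_interval continuous_on_sibuya_tail)
    show "\<forall>\<^sub>F n in sequentially. ?I n \<le> 1 / ln (real (Suc n))"
      using eventually_ge_at_top[of 1]
      by eventually_elim (use assms in \<open>rule integral_sibuya_tail_le\<close>)
    have "filterlim (\<lambda>n. ln (real (Suc n))) at_top sequentially"
      by (intro filterlim_compose[OF ln_at_top] filterlim_compose[OF filterlim_real_sequentially]
          filterlim_Suc)
    then show "(\<lambda>n. 1 / ln (real (Suc n))) \<longlonglongrightarrow> 0"
      by (intro tendsto_divide_0[OF tendsto_const] filterlim_at_top_imp_at_infinity)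
  qed
  then have "(\<lambda>n. 1 - ?I n / \<epsilon>) \<longlonglongrightarrow> 1 - 0 / \<epsilon>"
    using assms by (intro tendsto_intros) auto
  then show ?thesis by (simp add: sums_def_le eq)
qed

text \<open>Keep only \<alpha> in [\<delta>/2, \<delta>]: both the length of this interval and the
  lower bound for \<alpha> contribute \<delta>/2.\<close>

lemma B_avg_ge:
  assumes \<epsilon>: "0 < \<epsilon>" "\<epsilon> \<le> 1" and \<delta>: "0 < \<delta>" "\<delta> \<le> \<epsilon>" "\<delta> < 1" and "1 \<le> k"
  shows "\<delta>\<^sup>2 * (1 - \<delta>) / (4 * \<epsilon>) * real k powr - (1 + \<delta>) \<le> B_avg \<epsilon> (int k)"
proof -
  define c where "c = \<delta> / 2 * (1 - \<delta>) * real k powr - (1 + \<delta>)"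
  obtain j where k: "k = Suc j" using \<open>1 \<le> k\<close> by (cases k) auto
  have "\<delta> / 2 * c = integral {\<delta> / 2..\<delta>} (\<lambda>_. c)" using \<delta> by simp
  also have "\<dots> \<le> integral {\<delta> / 2..\<delta>} (\<lambda>\<alpha>. A_fun \<alpha> (int k))"
  proof (intro integral_le integrable_A_fun)
    fix \<alpha>
    assume \<alpha>: "\<alpha> \<in> {\<delta> / 2..\<delta>}"
    have "c = \<delta> / 2 / real k * ((1 - \<delta>) * real k powr - \<delta>)"
      using \<open>1 \<le> k\<close> by (simp add: c_def powr_diff powr_minus_divide)
    also have "\<dots> \<le> \<alpha> / real k * ((1 - \<alpha>) * real k powr - \<alpha>)"
      using \<alpha> \<delta> \<open>1 \<le> k\<close> by (intro mult_mono divide_right_mono powr_mono) auto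
    also have "\<dots> \<le> \<alpha> / real k * sibuya_tail \<alpha> j"
      using \<alpha> \<delta> unfolding k by (intro mult_left_mono sibuya_tail_ge) auto
    finally show "c \<le> A_fun \<alpha> (int k)" unfolding k A_fun_Suc .
  qed auto
  also have "\<dots> \<le> integral {0..\<epsilon>} (\<lambda>\<alpha>. A_fun \<alpha> (int k))"
    using \<epsilon> \<delta> by (intro integral_subset_le integrable_A_fun) (auto intro!: A_fun_nonneg)
  finally have "\<delta> / 2 * c / \<epsilon> \<le> B_avg \<epsilon> (int k)"
    unfolding B_avg_def using \<epsilon> by (intro divide_right_mono) auto
  then show ?thesis
    by (simp add: c_def power2_eq_square mult.assoc)
qed

text \<open>\<open>B_avg \<epsilon>\<close> vanishes at 0, so at each point only finitely many
  convolution powers contribute.\<close>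

lemma B_sub_eq_compose:
  "B_sub \<epsilon> \<beta> k = (if k < 0 then 0 else
    fps_nth (fps_compose (sibuya \<beta>) (seq_fps (B_avg \<epsilon>))) (nat k))"
proof -
  let ?g = "seq_fps (B_avg \<epsilon>)"
  have pow: "conv_pow (B_avg \<epsilon>) n k = (if k < 0 then 0 else fps_nth (?g ^ n) (nat k))" for n
    by (rule conv_pow_eq_fps) (simp add: B_avg_nonpos)
  have "fps_nth (?g ^ n) (nat k) = 0" if "nat k < n" for n
    using startsby_zero_power_prefix[of ?g] that by (simp add: B_avg_nonpos)
  then have "(\<Sum>n. A_fun \<beta> (int n) * fps_nth (?g ^ n) (nat k)) =
      (\<Sum>n\<le>nat k. A_fun \<beta> (int n) * fps_nth (?g ^ n) (nat k))"
    by (intro suminf_finite) auto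
  then show ?thesis
    by (simp add: B_sub_def pow fps_compose_nth atLeast0AtMost)
qed

theorem theorem6p1:
  fixes \<epsilon> \<beta> :: real
  assumes "0 < \<epsilon>" and "\<epsilon> \<le> 1" and "0 < \<beta>" and "\<beta> < 1"
  shows "B_sub \<epsilon> \<beta> \<in> classA \<and>
    (\<forall>\<alpha>. 0 < \<alpha> \<and> \<alpha> < 1 \<longrightarrow>
      ((\<lambda>\<xi>::real. \<bar>\<xi>\<bar> powr \<alpha> / cmod (1 - fourier (B_sub \<epsilon> \<beta>) \<xi>)) \<longlongrightarrow> 0) (at 0))"
proof -
  define f g where "f = sibuya \<beta>" and "g = seq_fps (B_avg \<epsilon>)"
  have f: "0 \<le> fps_nth f k" "fps_nth f sums 1" for k
    using assms sums_A_fun[of \<beta>] by (auto simp: f_def A_fun_nonneg fps_nth_seq_fps)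
  have g: "0 \<le> fps_nth g k" "fps_nth g sums 1" "fps_nth g 0 = 0" for k
    using assms sums_B_avg[of \<epsilon>] by (auto simp: g_def B_avg_nonneg B_avg_nonpos fps_nth_seq_fps)
  have B: "B_sub \<epsilon> \<beta> k = (if k < 0 then 0 else fps_nth (fps_compose f g) (nat k))" for k
    unfolding f_def g_def by (rule B_sub_eq_compose)
  have B_fps: "seq_fps (B_sub \<epsilon> \<beta>) = fps_compose f g"
    by (rule fps_ext) (simp add: B)
  have prob: "B_sub \<epsilon> \<beta> \<in> prob_Zplus"
    using fps_compose_nonneg[OF f(1) g(1)] sums_fps_compose[OF f g]
    by (intro prob_ZplusI) (auto simp: B)

  obtain C where C: "\<And>n k. 2 \<le> n \<Longrightarrow> real k * sibuya_pow \<beta> n k \<le> C"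
    using sibuya_pow_weighted_bound[OF assms(3,4)] by blast
  have "0 \<le> C" using C[of 2 0] by simp
  have norm: "(\<lambda>k. \<bar>conv_pow (B_sub \<epsilon> \<beta>) n k - conv_pow (B_sub \<epsilon> \<beta>) (Suc n) k\<bar>) summable_on UNIV
      \<and> real n * (\<Sum>\<^sub>\<infinity>k. \<bar>conv_pow (B_sub \<epsilon> \<beta>) n k - conv_pow (B_sub \<epsilon> \<beta>) (Suc n) k\<bar>) \<le> 2 * C / \<beta>"
    if n: "1 \<le> n" for n
  proof -
    define h where "h = (\<lambda>k. \<bar>conv_pow (B_sub \<epsilon> \<beta>) n k - conv_pow (B_sub \<epsilon> \<beta>) (Suc n) k\<bar>)"
    define K where "K = 2 * (C / (real (Suc n) * \<beta>))"
    have pow: "conv_pow (B_sub \<epsilon> \<beta>) m k = (if k < 0 then 0 else fps_nth (fps_compose (f ^ m) g) (nat k))" for m k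
      using conv_pow_eq_fps[of "B_sub \<epsilon> \<beta>" m k] by (simp add: B B_fps fps_compose_power[OF g(3)])
    \<comment> \<open>Composition with \<open>g\<close> respects powers and differences, which
      reduces the claim to f^n - f^(n+1).\<close>
    have h: "h k = (if k < 0 then 0 else \<bar>fps_nth (fps_compose (f ^ n - f ^ Suc n) g) (nat k)\<bar>)" for k
      unfolding h_def pow fps_compose_sub_distrib fps_sub_nth by simp
    have "(\<Sum>m\<le>N. h (int m)) \<le> K" for N
    proof -
      have "(\<Sum>m\<le>N. h (int m)) \<le> (\<Sum>k\<le>N. \<bar>fps_nth (f ^ n - f ^ Suc n) k\<bar>)"
        unfolding h using sum_abs_fps_compose_le[OF g(1,2), of "f ^ n - f ^ Suc n" N] by simp
      also have "\<dots> = (\<Sum>k<Suc N. \<bar>sibuya_diff \<beta> n k\<bar>)"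
        unfolding f_def sibuya_diff_def fps_sub_nth lessThan_Suc_atMost ..
      also have "\<dots> \<le> K"
        unfolding K_def using assms n by (intro sum_abs_sibuya_diff_le C) auto
      finally show ?thesis .
    qed
    then have "h summable_on UNIV" "infsum h UNIV \<le> K"
      by (auto intro!: infsum_int_le[of h] simp: h)
    moreover have "real n * K \<le> 2 * C / \<beta>"
    proof -
      have "real n * K = real n / real (Suc n) * (2 * C / \<beta>)" by (simp add: K_def)
      also have "\<dots> \<le> 1 * (2 * C / \<beta>)"
        using assms \<open>0 \<le> C\<close> by (intro mult_right_mono) auto
      finally show ?thesis by simp
    qed
    ultimately show ?thesis
      unfolding h_def[symmetric] using mult_left_mono[of "infsum h UNIV" K "real n"] by auto
  qed

  have "((\<lambda>\<xi>::real. \<bar>\<xi>\<bar> powr \<alpha> / cmod (1 - fourier (B_sub \<epsilon> \<beta>) \<xi>)) \<longlongrightarrow> 0) (at 0)"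
    if \<alpha>: "0 < \<alpha>" "\<alpha> < 1" for \<alpha>
  proof -
    \<comment> \<open>Below \<alpha> for the limit, and at most \<epsilon> so that
      [\<delta>/2, \<delta>] lies in the range of averaging.\<close>
    define \<delta> where "\<delta> = min \<alpha> \<epsilon> / 2"
    have \<delta>: "0 < \<delta>" "\<delta> \<le> \<epsilon>" "\<delta> < 1" "\<delta> < \<alpha>" using \<alpha> assms by (auto simp: \<delta>_def)
    define c where "c = \<beta> * (\<delta>\<^sup>2 * (1 - \<delta>) / (4 * \<epsilon>))"
    have "c * real k powr - (1 + \<delta>) \<le> B_sub \<epsilon> \<beta> (int k)" if "1 \<le> k" for k
    proof -
      have "c * real k powr - (1 + \<delta>) \<le> \<beta> * B_avg \<epsilon> (int k)"
        unfolding c_def mult.assoc using B_avg_ge[OF assms(1,2) \<delta>(1-3) that] assms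
        by (intro mult_left_mono) (auto simp: mult.assoc)
      \<comment> \<open>The single term with index 1, whose weight is A_\<beta>(1) = \<beta>,
        already suffices.\<close>
      also have "\<dots> = fps_nth f 1 * fps_nth (g ^ 1) k"
        using A_fun_Suc[of \<beta> 0] by (simp add: f_def g_def)
      also have "\<dots> \<le> (\<Sum>i = 0..k. fps_nth f i * fps_nth (g ^ i) k)"
        using that f g fps_power_nonneg[of g]
        by (intro member_le_sum[of 1 _ "\<lambda>i. fps_nth f i * fps_nth (g ^ i) k"]) auto
      finally show ?thesis by (simp add: B fps_compose_nth)
    qed
    moreover have "0 < c" using assms \<delta> by (simp add: c_def)
    ultimately show ?thesis
      using prob \<delta> by (intro tendsto_powr_div_fourier[where c = c and \<delta> = \<delta>]) auto
  qed
  with prob norm show ?thesis by (auto simp: classA_def)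
qed

end
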